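(* Let $n \ge 1$ and $U \subseteq \mathbb{Z}_3^n$. If $|U| \ge 3^{n-1}+1$, the subgraph of $H(n,3)$ induced by $U$ has maximum degree $1$, and $U$ is disjoint from some maximum size independent set of $H(n,3)$, then there exists an automorphism $\sigma$ of $H(n,3)$ such that $\sigma(U) = D_n$.
   Context: $H(n,3)$ is the Hamming graph on $\mathbb{Z}_3^n$ (vertices adjacent iff they differ in exactly one coordinate); a maximum size independent set is one of largest cardinality. $A_n = \{x \in \mathbb{Z}_3^n : \sum_i x_i \equiv 0 \pmod 3\}$. For $S \subseteq \mathbb{Z}_3^{n}$ and $c \in \mathbb{Z}_3$, $(S,c) = \{(x_1,\dots,x_{n},c) : (x_1,\dots,x_n) \in S\}$. The sets $D_n \subseteq \mathbb{Z}_3^n$ are defined by $D_1 = \{1,2\}$ and $D_{n+1} = (D_n,0) \cup (A_n,1) \cup (A_n,2)$. *)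

theory Defs
  imports Main "HOL-Library.Numeral_Type"
begin

record 'v sgraph =
  verts :: "'v set"
  adj :: "'v \<Rightarrow> 'v \<Rightarrow> bool"

definition induced :: "'v sgraph \<Rightarrow> 'v set \<Rightarrow> 'v sgraph" where
  "induced G U = \<lparr>verts = U, adj = (\<lambda>x y. x \<in> U \<and> y \<in> U \<and> adj G x y)\<rparr>"

definition degree :: "'v sgraph \<Rightarrow> 'v \<Rightarrow> nat" where
  "degree G x = card {y \<in> verts G. adj G x y}"

(* Meaningful for finite graphs with at least one vertex only. *)
definition max_degree :: "'v sgraph \<Rightarrow> nat" where
  "max_degree G = Max (degree G ` verts G)"

definition independent_set :: "'v sgraph \<Rightarrow> 'v set \<Rightarrow> bool" where
  "independent_set G I \<longleftrightarrow> I \<subseteq> verts G \<and> (\<forall>x\<in>I. \<forall>y\<in>I. \<not> adj G x y)"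

(* Intended for finite graphs: card is 0 on infinite sets. *)
definition maximum_independent_set :: "'v sgraph \<Rightarrow> 'v set \<Rightarrow> bool" where
  "maximum_independent_set G I \<longleftrightarrow>
     independent_set G I \<and> (\<forall>J. independent_set G J \<longrightarrow> card J \<le> card I)"

definition automorphism :: "'v sgraph \<Rightarrow> ('v \<Rightarrow> 'v) \<Rightarrow> bool" where
  "automorphism G \<sigma> \<longleftrightarrow>
     bij_betw \<sigma> (verts G) (verts G) \<and>
     (\<forall>x\<in>verts G. \<forall>y\<in>verts G. adj G (\<sigma> x) (\<sigma> y) \<longleftrightarrow> adj G x y)"

(* The numeral type 3 is the ring of integers modulo 3; a vector of length n over it
   is a list, its first coordinate being the head. *)
definition Z3_pow :: "nat \<Rightarrow> 3 list set" where
  "Z3_pow n = {x. length x = n}"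

definition hamming3 :: "nat \<Rightarrow> 3 list sgraph" where
  "hamming3 n = \<lparr>verts = Z3_pow n,
     adj = (\<lambda>x y. x \<in> Z3_pow n \<and> y \<in> Z3_pow n \<and> card {i. i < n \<and> x ! i \<noteq> y ! i} = 1)\<rparr>"

(* Arithmetic in type 3 is modulo 3, so this is the set of vectors with coordinate sum
   congruent to 0 modulo 3. *)
definition A_set :: "nat \<Rightarrow> 3 list set" where
  "A_set n = {x \<in> Z3_pow n. sum_list x = 0}"

definition append_coord :: "3 list set \<Rightarrow> 3 \<Rightarrow> 3 list set" where
  "append_coord S c = (\<lambda>x. x @ [c]) ` S"

(* The sets are indexed from 1; the value at 0 is a dummy. *)
fun D_set :: "nat \<Rightarrow> 3 list set" where
  "D_set 0 = {}"
| "D_set (Suc 0) = {[1], [2]}"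
| "D_set (Suc (Suc n)) =
     append_coord (D_set (Suc n)) 0 \<union>
     append_coord (A_set (Suc n)) 1 \<union>
     append_coord (A_set (Suc n)) 2"

end

(* Up to an automorphism the maximum independent set is the sum-zero set, so U meets every line
   in at most two points. Induct on the dimension. If U is larger than 3^(n-1), then in every
   direction exactly one of the three parallel slices is larger than 3^(n-2); by induction it is
   a copy of D_(n-1), which has no isolated vertices, so it is disjoint from the other two slices,
   and these have exactly 3^(n-2) elements. Slice U first in one direction, and then in the
   direction of the last coordinate of the copy of D_(n-1) in the large slice. This gives a
   3 x 3 grid of sets of codimension two whose first row is a copy of D_(n-2) followed by two
   equal sum classes. Counting and the degree condition force, in at least one of the two
   directions, the two small slices to be equal sum classes, unless n = 3, where the third
   direction has this property. *)
theory Submission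
  imports Defs
begin

section \<open>Hamming distance and slices\<close>

lemma Z3_cases: "(x::3) = 0 \<or> x = 1 \<or> x = 2"
proof (cases x)
  case (of_int z)
  then have "z = 0 \<or> z = 1 \<or> z = 2" by auto
  with of_int show ?thesis by auto
qed

lemma Z3_neq_iff: "(a::3) \<noteq> b \<longleftrightarrow> a = b + 1 \<or> a = b + 2"
  using Z3_cases[of a] Z3_cases[of b] by (elim disjE) simp_all

lemma Z3_arith: "s - 1 = s + (2::3)" "s - 2 = s + (1::3)" "(3::3) = 0" "(4::3) = 1"
  by simp_all

text \<open>Counting over \<open>zip\<close>, where \<open>hamming3\<close> counts indices, makes
  the distance compute along \<open>Cons\<close> and append; \<open>adj_hamming3\<close> links the
  two.\<close>

definition hdist :: "'a list \<Rightarrow> 'a list \<Rightarrow> nat" where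
  "hdist x y = length (filter (\<lambda>(a, b). a \<noteq> b) (zip x y))"

lemma hdist_Nil [simp]: "hdist [] [] = 0"
  by (simp add: hdist_def)

lemma hdist_Cons [simp]: "hdist (a # x) (b # y) = (if a = b then 0 else 1) + hdist x y"
  by (simp add: hdist_def)

lemma hdist_append [simp]:
  "length x = length y \<Longrightarrow> hdist (x @ x') (y @ y') = hdist x y + hdist x' y'"
  by (simp add: hdist_def)

lemma hdist_eq_0_iff: "length x = length y \<Longrightarrow> hdist x y = 0 \<longleftrightarrow> x = y"
  by (induction x y rule: list_induct2) auto

lemma hdist_self [simp]: "hdist x x = 0"
  by (simp add: hdist_eq_0_iff)

lemma hdist_rev: "length x = length y \<Longrightarrow> hdist (rev x) (rev y) = hdist x y"
  by (induction x y rule: list_induct2) auto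

lemma adj_hamming3:
  assumes "length x = n" "length y = n"
  shows "adj (hamming3 n) x y \<longleftrightarrow> hdist x y = 1"
proof -
  have "hdist x y = card {i. i < n \<and> x ! i \<noteq> y ! i}"
    unfolding hdist_def length_filter_conv_card using assms
    by (intro arg_cong[where f = card]) auto
  then show ?thesis using assms by (simp add: hamming3_def Z3_pow_def)
qed

section \<open>Inserting a coordinate at a given position\<close>

definition ins :: "nat \<Rightarrow> 'a \<Rightarrow> 'a list \<Rightarrow> 'a list" where
  "ins i c y = take i y @ c # drop i y"

lemma ins_0 [simp]: "ins 0 c y = c # y"
  by (simp add: ins_def)

lemma ins_Suc_Cons [simp]: "ins (Suc i) c (a # y) = a # ins i c y"
  by (simp add: ins_def)

lemma length_ins [simp]: "length (ins i c y) = Suc (length y)"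
  by (simp add: ins_def)

lemma sum_list_ins [simp]: "sum_list (ins i c y) = c + (sum_list y :: 'a :: comm_monoid_add)"
proof -
  have "sum_list (take i y @ drop i y) = sum_list y" by simp
  then show ?thesis unfolding ins_def sum_list_append by (simp add: ac_simps)
qed

lemma hdist_ins [simp]:
  assumes "length x = length y"
  shows "hdist (ins i a x) (ins i b y) = (if a = b then 0 else 1) + hdist x y"
proof -
  have "hdist (take i x @ drop i x) (take i y @ drop i y)
    = hdist (take i x) (take i y) + hdist (drop i x) (drop i y)"
    using assms by (intro hdist_append) simp
  then show ?thesis using assms by (simp add: ins_def)
qed

lemma ins_eq_iff:
  assumes "length x = length y"
  shows "ins i a x = ins i b y \<longleftrightarrow> a = b \<and> x = y"
proof -
  have "ins i a x = ins i b y \<longleftrightarrow> hdist (ins i a x) (ins i b y) = 0"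
    using assms by (intro hdist_eq_0_iff[symmetric]) simp
  also have "\<dots> \<longleftrightarrow> a = b \<and> x = y"
    using assms by (simp add: hdist_eq_0_iff)
  finally show ?thesis .
qed

lemma ins_exhaust:
  assumes "length z = Suc n" "i \<le> n"
  obtains c y where "z = ins i c y" "length y = n"
proof
  show "z = ins i (z ! i) (take i z @ drop (Suc i) z)"
    using assms by (simp add: ins_def id_take_nth_drop min_def)
  show "length (take i z @ drop (Suc i) z) = n" using assms by simp
qed

section \<open>Sum classes and slices\<close>

definition V :: "nat \<Rightarrow> 3 \<Rightarrow> 3 list set" where
  "V n s = {x \<in> Z3_pow n. sum_list x = s}"

lemma mem_V: "x \<in> V n s \<longleftrightarrow> length x = n \<and> sum_list x = s"
  by (simp add: V_def Z3_pow_def)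

text \<open>All three sum classes are needed, because splitting off a coordinate \<open>c\<close>
  turns the class of \<open>s\<close> into that of \<open>s - c\<close>.\<close>

lemma A_set_eq_V: "A_set n = V n 0"
  by (simp add: A_set_def V_def)

lemma finite_Z3_pow [simp]: "finite (Z3_pow n)"
  using finite_lists_length_eq[of "UNIV :: 3 set" n] by (simp add: Z3_pow_def)

lemma card_Z3_pow: "card (Z3_pow n) = 3 ^ n"
  using card_lists_length_eq[of "UNIV :: 3 set" n] by (simp add: Z3_pow_def)

lemma V_subset: "V n s \<subseteq> Z3_pow n"
  by (auto simp: V_def)

lemma finite_V [simp]: "finite (V n s)"
  using V_subset finite_Z3_pow finite_subset by blast

text \<open>The head is determined by the tail and the required sum.\<close>

lemma card_V: "card (V (Suc n) s) = 3 ^ n"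
proof -
  have "V (Suc n) s = (\<lambda>y. (s - sum_list y) # y) ` Z3_pow n"
    by (auto simp: mem_V Z3_pow_def length_Suc_conv image_iff)
  moreover have "inj_on (\<lambda>y. (s - sum_list y) # y) (Z3_pow n)"
    by (auto intro: inj_onI)
  ultimately show ?thesis by (simp add: card_image card_Z3_pow)
qed

text \<open>The fixed coordinate is deleted, so that parallel slices lie in one space and can be
  compared and intersected.\<close>

definition slice :: "nat \<Rightarrow> 3 \<Rightarrow> 3 list set \<Rightarrow> 3 list set" where
  "slice i c U = {y. ins i c y \<in> U}"

lemma mem_slice [simp]: "y \<in> slice i c U \<longleftrightarrow> ins i c y \<in> U"
  by (simp add: slice_def)

lemma slice_subset: "U \<subseteq> Z3_pow (Suc n) \<Longrightarrow> slice i c U \<subseteq> Z3_pow n"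
  by (auto simp: Z3_pow_def)

lemma length_slice: "U \<subseteq> Z3_pow (Suc n) \<Longrightarrow> ins i c y \<in> U \<Longrightarrow> length y = n"
  by (auto simp: Z3_pow_def)

text \<open>Counting from an arbitrary \<open>c\<close> lets the distinguished slice come first in
  the sum.\<close>

lemma card_slices:
  assumes U: "U \<subseteq> Z3_pow (Suc n)" and i: "i \<le> n"
  shows "card U = card (slice i c U) + card (slice i (c + 1) U) + card (slice i (c + 2) U)"
proof -
  let ?S = "\<lambda>c. ins i c ` slice i c U"
  have len: "length y = n" if "y \<in> slice i c U" for y c
    using that length_slice[OF U] by simp
  have "U = (\<Union>d\<in>{c, c + 1, c + 2}. ?S d)"
  proof
    show "U \<subseteq> (\<Union>d\<in>{c, c + 1, c + 2}. ?S d)"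
    proof
      fix z assume z: "z \<in> U"
      moreover from this obtain d y where zd: "z = ins i d y"
        using ins_exhaust[OF _ i, of z] U unfolding Z3_pow_def by blast
      ultimately have "z \<in> ?S d" by simp
      moreover have "d \<in> {c, c + 1, c + 2}" using Z3_neq_iff[of d c] by blast
      ultimately show "z \<in> (\<Union>d\<in>{c, c + 1, c + 2}. ?S d)" by blast
    qed
  qed auto
  then have eq: "U = ?S c \<union> ?S (c + 1) \<union> ?S (c + 2)"
    by (simp add: Un_assoc)
  have fin: "finite (slice i c U)" for c
    using slice_subset[OF U] finite_Z3_pow finite_subset by blast
  have disj: "?S a \<inter> ?S b = {}" if "a \<noteq> b" for a b
  proof (rule ccontr)
    assume "?S a \<inter> ?S b \<noteq> {}"
    then obtain x y where "x \<in> slice i a U" "y \<in> slice i b U" "ins i a x = ins i b y" by blast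
    then show False using that len[of x a] len[of y b] by (simp add: ins_eq_iff del: mem_slice)
  qed
  have card: "card (?S a) = card (slice i a U)" for a
    by (rule card_image) (auto intro!: inj_onI simp: ins_eq_iff len simp del: mem_slice)
  have "card U = card (?S c \<union> ?S (c + 1) \<union> ?S (c + 2))"
    by (rule arg_cong[OF eq])
  also have "\<dots> = card (?S c \<union> ?S (c + 1)) + card (?S (c + 2))"
    using fin disj[of c "c + 2"] disj[of "c + 1" "c + 2"]
    by (intro card_Un_disjoint) (simp_all add: Int_Un_distrib2)
  also have "card (?S c \<union> ?S (c + 1)) = card (?S c) + card (?S (c + 1))"
    using fin disj[of c "c + 1"] by (intro card_Un_disjoint) simp_all
  finally show ?thesis by (simp only: card)
qed

section \<open>Independent sets\<close>

text \<open>Maximum degree at most 1, phrased as uniqueness of the neighbour so that it passes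
  directly to slices and isometric images.\<close>

definition sparse :: "'a list set \<Rightarrow> bool" where
  "sparse U \<longleftrightarrow> (\<forall>x\<in>U. \<forall>y\<in>U. \<forall>z\<in>U. hdist x y = 1 \<longrightarrow> hdist x z = 1 \<longrightarrow> y = z)"

definition indep :: "'a list set \<Rightarrow> bool" where
  "indep S \<longleftrightarrow> (\<forall>x\<in>S. \<forall>y\<in>S. hdist x y \<noteq> 1)"

lemma indep_slice:
  assumes "indep S" "S \<subseteq> Z3_pow (Suc n)"
  shows "indep (slice i c S)"
proof -
  have len: "length y = n" if "y \<in> slice i c S" for y
    using that length_slice[OF assms(2)] by simp
  show ?thesis unfolding indep_def
  proof (intro ballI)
    fix x y assume xy: "x \<in> slice i c S" "y \<in> slice i c S"
    then have "hdist (ins i c x) (ins i c y) = hdist x y" using len by (simp del: mem_slice)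
    moreover have "hdist (ins i c x) (ins i c y) \<noteq> 1"
      using xy assms(1) by (auto simp: indep_def)
    ultimately show "hdist x y \<noteq> 1" by simp
  qed
qed

lemma disjnt_slices:
  assumes "indep S" "S \<subseteq> Z3_pow (Suc n)" "a \<noteq> b"
  shows "slice i a S \<inter> slice i b S = {}"
proof (rule ccontr)
  assume "slice i a S \<inter> slice i b S \<noteq> {}"
  then obtain y where "ins i a y \<in> S" "ins i b y \<in> S" by auto
  moreover have "hdist (ins i a y) (ins i b y) = 1" using assms(3) by simp
  ultimately show False using assms(1) unfolding indep_def by blast
qed

text \<open>Points with the same tail are equal or adjacent, so an independent set injects into the
  space of tails.\<close>

lemma card_indep_le:
  assumes "indep S" "S \<subseteq> Z3_pow (Suc n)"
  shows "card S \<le> 3 ^ n"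
proof -
  have "inj_on tl S"
  proof (rule inj_onI)
    fix x y assume xy: "x \<in> S" "y \<in> S" "tl x = tl y"
    then obtain a b v where [simp]: "x = a # v" "y = b # v"
      using assms(2) by (cases x; cases y) (auto simp: Z3_pow_def)
    have "hdist x y \<noteq> 1" using xy assms(1) unfolding indep_def by blast
    then show "x = y" by (auto split: if_splits)
  qed
  moreover have "tl ` S \<subseteq> Z3_pow n" using assms(2) by (auto simp: Z3_pow_def)
  ultimately show ?thesis
    using card_inj_on_le[of tl S "Z3_pow n"] by (simp add: card_Z3_pow)
qed

text \<open>Changing exactly one coordinate changes the coordinate sum.\<close>

lemma indep_V: "indep (V n s)"
  unfolding indep_def
proof (intro ballI)
  fix x y assume xy: "x \<in> V n s" "y \<in> V n s"
  have *: "length x = length y \<Longrightarrow> hdist x y = 1 \<Longrightarrow> sum_list x \<noteq> sum_list y" for x y :: "3 list"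
    by (induction x y rule: list_induct2) (auto simp: hdist_eq_0_iff split: if_splits)
  show "hdist x y \<noteq> 1" using *[of x y] xy by (auto simp: mem_V)
qed

text \<open>Each of the three slices has at most \<open>3 ^ n\<close> points by
  \<open>card_indep_le\<close>, and their total leaves no slack.\<close>

lemma card_slice_max_indep:
  assumes S: "indep S" "S \<subseteq> Z3_pow (Suc (Suc n))" "card S = 3 ^ Suc n" and i: "i \<le> Suc n"
  shows "card (slice i c S) = 3 ^ n"
proof -
  have le: "card (slice i d S) \<le> 3 ^ n" for d
    using S slice_subset by (intro card_indep_le indep_slice) auto
  show ?thesis
    using card_slices[OF S(2) i, of c] S(3) le[of c] le[of "c + 1"] le[of "c + 2"] by simp
qed

lemma eq_V_if_head_slices:
  assumes "S \<subseteq> Z3_pow (Suc n)" "\<And>c. slice 0 c S = V n (s - c)"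
  shows "S = V (Suc n) s"
proof (rule set_eqI)
  fix x
  show "x \<in> S \<longleftrightarrow> x \<in> V (Suc n) s"
  proof (cases x)
    case Nil
    then show ?thesis using assms(1) by (auto simp: mem_V Z3_pow_def)
  next
    case (Cons c y)
    have "x \<in> S \<longleftrightarrow> y \<in> slice 0 c S" by (simp add: Cons)
    also have "\<dots> \<longleftrightarrow> x \<in> V (Suc n) s" by (auto simp: assms(2) mem_V Cons algebra_simps)
    finally show ?thesis .
  qed
qed

text \<open>By induction, head slice \<open>c\<close> is one of the two sum classes other than that
  of \<open>s - c\<close>. Slices of an independent set are disjoint, so the three classes are
  distinct and form a derangement. The only derangements of three objects are the two cyclic shifts,
  and each glues to a single class.\<close>

lemma max_indep_avoiding_V:
  assumes "indep S" "S \<subseteq> Z3_pow (Suc n)" "card S = 3 ^ n" "S \<inter> V (Suc n) s = {}"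
  shows "S = V (Suc n) (s + 1) \<or> S = V (Suc n) (s + 2)"
  using assms
proof (induction n arbitrary: S s)
  case 0
  then obtain x where x: "S = {x}" by (auto simp: card_Suc_eq)
  moreover obtain a where "x = [a]"
    using 0(2) x by (auto simp: Z3_pow_def length_Suc_conv)
  ultimately have S: "S = {[a]}" by simp
  have V: "V (Suc 0) r = {[r]}" for r by (auto simp: mem_V length_Suc_conv)
  from S 0(4) have "a \<noteq> s" by (auto simp: V)
  then show ?case unfolding Z3_neq_iff S V by blast
next
  case (Suc n)
  have sl: "slice 0 c S = V (Suc n) (s - c + 1) \<or> slice 0 c S = V (Suc n) (s - c + 2)" for c
  proof (rule Suc.IH)
    show "slice 0 c S \<inter> V (Suc n) (s - c) = {}"
      using Suc.prems(4) by (auto simp: mem_V algebra_simps)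
    show "card (slice 0 c S) = 3 ^ n" using Suc.prems by (intro card_slice_max_indep) auto
  qed (use Suc.prems in \<open>auto intro: indep_slice simp: slice_subset\<close>)
  have ne: "V (Suc n) r \<noteq> {}" for r using card_V[of n r] by force
  have disj: "slice 0 a S \<noteq> slice 0 b S" if "a \<noteq> b" for a b
    using disjnt_slices[OF Suc.prems(1,2) that, of 0] sl[of a] ne by force
  have "slice 0 0 S = V (Suc n) (s + 1) \<and> slice 0 1 S = V (Suc n) s \<and> slice 0 2 S = V (Suc n) (s + 2)
    \<or> slice 0 0 S = V (Suc n) (s + 2) \<and> slice 0 2 S = V (Suc n) s \<and> slice 0 1 S = V (Suc n) (s + 1)"
  proof -
    have "slice 0 0 S = V (Suc n) (s + 1) \<or> slice 0 0 S = V (Suc n) (s + 2)"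
      using sl[of 0] by simp
    moreover have "slice 0 1 S = V (Suc n) s \<or> slice 0 1 S = V (Suc n) (s + 1)"
      using sl[of 1] by (simp add: add.commute)
    moreover have "slice 0 2 S = V (Suc n) (s + 2) \<or> slice 0 2 S = V (Suc n) s"
    using sl[of 2] by (simp add: Z3_arith add.commute)
    moreover have "slice 0 0 S \<noteq> slice 0 1 S" "slice 0 0 S \<noteq> slice 0 2 S" "slice 0 1 S \<noteq> slice 0 2 S"
      by (rule disj, simp)+
    ultimately show ?thesis by argo
  qed
  then show ?case
  proof
    assume *: "slice 0 0 S = V (Suc n) (s + 1) \<and> slice 0 1 S = V (Suc n) s \<and> slice 0 2 S = V (Suc n) (s + 2)"
    have "slice 0 c S = V (Suc n) (s + 1 - c)" for c
      using * Z3_cases[of c] by (elim disjE) (simp_all add: Z3_arith add.commute)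
    then have "S = V (Suc (Suc n)) (s + 1)"
      by (rule eq_V_if_head_slices[OF Suc.prems(2)])
    then show ?thesis ..
  next
    assume *: "slice 0 0 S = V (Suc n) (s + 2) \<and> slice 0 2 S = V (Suc n) s \<and> slice 0 1 S = V (Suc n) (s + 1)"
    have "slice 0 c S = V (Suc n) (s + 2 - c)" for c
      using * Z3_cases[of c] by (auto simp: algebra_simps)
    then have "S = V (Suc (Suc n)) (s + 2)"
      by (rule eq_V_if_head_slices[OF Suc.prems(2)])
    then show ?thesis ..
  qed
qed

section \<open>Isometries and the normal form of a maximum independent set\<close>

definition isometry :: "nat \<Rightarrow> ('a list \<Rightarrow> 'a list) \<Rightarrow> bool" where
  "isometry n \<sigma> \<longleftrightarrow> (\<forall>x. length x = n \<longrightarrow> length (\<sigma> x) = n) \<and>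
     (\<forall>x y. length x = n \<longrightarrow> length y = n \<longrightarrow> hdist (\<sigma> x) (\<sigma> y) = hdist x y)"

lemma isometry_comp: "isometry n \<sigma> \<Longrightarrow> isometry n \<tau> \<Longrightarrow> isometry n (\<tau> \<circ> \<sigma>)"
  by (simp add: isometry_def)

lemma isometry_rev: "isometry n rev"
  by (simp add: isometry_def hdist_rev)

text \<open>Distance 0 means equality, so preserving distances gives injectivity; the space is
  finite.\<close>

lemma isometry_bij_betw:
  fixes \<sigma> :: "3 list \<Rightarrow> 3 list"
  assumes "isometry n \<sigma>"
  shows "bij_betw \<sigma> (Z3_pow n) (Z3_pow n)"
proof -
  have "inj_on \<sigma> (Z3_pow n)"
  proof (rule inj_onI)
    fix x y assume "x \<in> Z3_pow n" "y \<in> Z3_pow n" "\<sigma> x = \<sigma> y"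
    moreover from this have "hdist (\<sigma> x) (\<sigma> y) = hdist x y"
      using assms unfolding isometry_def Z3_pow_def by blast
    ultimately show "x = y" by (simp add: hdist_eq_0_iff Z3_pow_def)
  qed
  moreover have "\<sigma> ` Z3_pow n \<subseteq> Z3_pow n"
    using assms by (auto simp: isometry_def Z3_pow_def)
  ultimately show ?thesis
    by (simp add: bij_betw_def endo_inj_surj)
qed

lemma isometry_automorphism:
  assumes "isometry n \<sigma>"
  shows "automorphism (hamming3 n) \<sigma>"
proof -
  have "verts (hamming3 n) = Z3_pow n" by (simp add: hamming3_def)
  then show ?thesis
    using assms isometry_bij_betw[OF assms]
    by (simp add: automorphism_def isometry_def adj_hamming3 Z3_pow_def)
qed

lemma isometry_image_eqI:
  assumes "isometry n \<sigma>" "U \<subseteq> Z3_pow n" "W \<subseteq> Z3_pow n"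
    and "\<And>x. x \<in> Z3_pow n \<Longrightarrow> x \<in> U \<longleftrightarrow> \<sigma> x \<in> W"
  shows "\<sigma> ` U = W"
proof
  show "\<sigma> ` U \<subseteq> W" using assms by blast
  show "W \<subseteq> \<sigma> ` U"
  proof
    fix w assume "w \<in> W"
    then have "w \<in> \<sigma> ` Z3_pow n"
      using isometry_bij_betw[OF assms(1)] assms(3) by (auto simp: bij_betw_def)
    with \<open>w \<in> W\<close> show "w \<in> \<sigma> ` U" using assms(4) by blast
  qed
qed

lemma indep_image:
  assumes "isometry n \<sigma>" "S \<subseteq> Z3_pow n" "indep S"
  shows "indep (\<sigma> ` S)"
  using assms unfolding isometry_def indep_def Z3_pow_def by (auto simp: subset_iff)

lemma sparse_image:
  assumes "isometry n \<sigma>" "S \<subseteq> Z3_pow n" "sparse S"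
  shows "sparse (\<sigma> ` S)"
  using assms unfolding isometry_def sparse_def Z3_pow_def by (auto simp: subset_iff)

lemma card_isometry_image:
  fixes S :: "3 list set"
  assumes "isometry n \<sigma>" "S \<subseteq> Z3_pow n"
  shows "card (\<sigma> ` S) = card S"
  using inj_on_subset[OF bij_betw_imp_inj_on[OF isometry_bij_betw[OF assms(1)]] assms(2)]
  by (rule card_image)

text \<open>The induction hypothesis normalizes head slice 0. The same map takes the other two
  slices to maximum independent sets disjoint from class 0, hence to classes 1 and 2 in some order,
  which a permutation of the head symbols corrects.\<close>

lemma max_indep_isometry:
  assumes "indep S" "S \<subseteq> Z3_pow (Suc n)" "card S = 3 ^ n"
  shows "\<exists>\<sigma>. isometry (Suc n) \<sigma> \<and> (\<forall>x\<in>Z3_pow (Suc n). x \<in> S \<longleftrightarrow> \<sigma> x \<in> V (Suc n) 0)"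
  using assms
proof (induction n arbitrary: S)
  case 0
  then obtain x where x: "S = {x}" by (auto simp: card_Suc_eq)
  moreover obtain a where "x = [a]"
    using 0(2) x by (auto simp: Z3_pow_def length_Suc_conv)
  ultimately have S: "S = {[a]}" by simp
  show ?case
    by (rule exI[of _ "map (\<lambda>b. b - a)"])
      (auto simp: isometry_def S mem_V Z3_pow_def length_Suc_conv)
next
  case (Suc n)
  have sub: "slice 0 c S \<subseteq> Z3_pow (Suc n)" for c using Suc.prems by (simp add: slice_subset)
  have ind: "indep (slice 0 c S)" for c using Suc.prems by (intro indep_slice) auto
  have card: "card (slice 0 c S) = 3 ^ n" for c using Suc.prems by (intro card_slice_max_indep) auto
  obtain \<sigma> where \<sigma>: "isometry (Suc n) \<sigma>"
    "\<And>x. x \<in> Z3_pow (Suc n) \<Longrightarrow> x \<in> slice 0 0 S \<longleftrightarrow> \<sigma> x \<in> V (Suc n) 0"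
    using Suc.IH[OF ind sub card] by metis
  note inj = isometry_bij_betw[OF \<sigma>(1), THEN bij_betw_imp_inj_on]
  define T where "T c = \<sigma> ` slice 0 c S" for c
  have mem_T: "a # y \<in> S \<longleftrightarrow> \<sigma> y \<in> T a" if "length y = Suc n" for a y
    unfolding T_def using inj_on_image_mem_iff[OF inj _ sub, of y a] that
    by (auto simp: Z3_pow_def)
  have T0: "T 0 = V (Suc n) 0"
    unfolding T_def using \<sigma> sub V_subset by (intro isometry_image_eqI)
  have disj: "T a \<inter> T b = {}" if "a \<noteq> b" for a b
    unfolding T_def using inj_on_image_Int[OF inj sub sub, of a b]
      disjnt_slices[OF Suc.prems(1,2) that, of 0] by simp
  have T: "T c = V (Suc n) 1 \<or> T c = V (Suc n) 2" if "c \<noteq> 0" for c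
  proof -
    have "T c = V (Suc n) (0 + 1) \<or> T c = V (Suc n) (0 + 2)"
    proof (rule max_indep_avoiding_V)
      show "indep (T c)" unfolding T_def by (rule indep_image[OF \<sigma>(1) sub ind])
      show "T c \<subseteq> Z3_pow (Suc n)"
        unfolding T_def using \<sigma>(1) sub[of c] by (auto simp: isometry_def Z3_pow_def subset_iff)
      show "card (T c) = 3 ^ n"
        unfolding T_def using card card_isometry_image[OF \<sigma>(1) sub] by simp
      show "T c \<inter> V (Suc n) 0 = {}" using disj[OF that] T0 by simp
    qed
    then show ?thesis by simp
  qed
  have "V (Suc n) r \<noteq> {}" for r using card_V[of n r] by force
  then have "T 1 \<noteq> {}" using T[of 1] by auto
  moreover have "T 1 \<inter> T 2 = {}" by (rule disj) simp
  ultimately have ne: "T 1 \<noteq> T 2" by blast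
  \<comment> \<open>\<open>e\<close> is 1 or 2 according to the order in which classes 1 and 2
    occur.\<close>
  have "\<exists>e. e \<noteq> 0 \<and> (\<forall>a. T a = V (Suc n) (e * a))"
  proof (cases "T 1 = V (Suc n) 1")
    case True
    then have "T a = V (Suc n) (1 * a)" for a using T0 ne T[of 2] Z3_cases[of a] by auto
    then show ?thesis by (metis zero_neq_one)
  next
    case False
    then have "T 1 = V (Suc n) 2" "T 2 = V (Suc n) 1" using ne T[of 1] T[of 2] by auto
    moreover have "(2::3) * 2 = 1" by simp
    ultimately have "T a = V (Suc n) (2 * a)" for a
      using T0 Z3_cases[of a] by (elim disjE) (simp_all only: mult_zero_right mult_1_right)
    moreover have "(2::3) \<noteq> 0" by simp
    ultimately show ?thesis by metis
  qed
  then obtain e where e: "e \<noteq> 0" "\<And>a. T a = V (Suc n) (e * a)" by metis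
  have e_inj: "e * a = e * b \<longleftrightarrow> a = b" for a b
    using e(1) Z3_cases[of e] Z3_cases[of a] Z3_cases[of b] by auto
  \<comment> \<open>The image of a tail from slice \<open>a\<close> of \<open>S\<close> has sum
    \<open>e * a\<close>, so the head \<open>- (e * a)\<close> brings the total to 0.\<close>
  define \<tau> where "\<tau> x = (- (e * hd x)) # \<sigma> (tl x)" for x
  have "isometry (Suc (Suc n)) \<tau>"
    using \<sigma>(1) e_inj by (auto simp: isometry_def \<tau>_def length_Suc_conv)
  moreover have "x \<in> S \<longleftrightarrow> \<tau> x \<in> V (Suc (Suc n)) 0" if x: "x \<in> Z3_pow (Suc (Suc n))" for x
  proof -
    obtain a y where x: "x = a # y" "length y = Suc n"
      using x by (auto simp: Z3_pow_def length_Suc_conv)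
    have "length (\<sigma> y) = Suc n" using \<sigma>(1) x(2) by (simp add: isometry_def)
    then show ?thesis
      using mem_T[OF x(2), of a] unfolding x(1) \<tau>_def e(2) by (auto simp: mem_V algebra_simps)
  qed
  ultimately show ?case by blast
qed

section \<open>Sets equivalent to $D_n$\<close>

text \<open>Copies of $D_n$ under coordinate permutations and a translation; the parameter s is the
  coordinate sum that the copy avoids. Unlike in the definition of $D_n$, the coordinate split off
  may be any one, which is what makes this notion suited to induction.\<close>

inductive Dlike :: "nat \<Rightarrow> 3 \<Rightarrow> 3 list set \<Rightarrow> bool" where
  base: "Dlike 1 s {[s + 1], [s + 2]}"
| step: "U \<subseteq> Z3_pow (Suc n) \<Longrightarrow> i \<le> n \<Longrightarrow> Dlike n (s - c) (slice i c U) \<Longrightarrow>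
    (\<And>d. d \<noteq> c \<Longrightarrow> slice i d U = V n (s - c)) \<Longrightarrow> Dlike (Suc n) s U"

text \<open>\<open>D_set\<close> with the coordinates reversed, so that the recursion is on the head
  of the list.\<close>

fun D_rev :: "nat \<Rightarrow> 3 list set" where
  "D_rev 0 = {}"
| "D_rev (Suc 0) = {[1], [2]}"
| "D_rev (Suc (Suc n)) = Cons 0 ` D_rev (Suc n) \<union> Cons 1 ` V (Suc n) 0 \<union> Cons 2 ` V (Suc n) 0"

lemma rev_D_rev: "rev ` D_rev n = D_set n"
proof (induction n rule: D_rev.induct)
  case (3 n)
  have "rev ` V (Suc n) 0 = A_set (Suc n)"
  proof -
    have "x \<in> rev ` V (Suc n) 0" if "x \<in> A_set (Suc n)" for x
      using that by (intro rev_image_eqI[of "rev x"]) (auto simp: A_set_eq_V mem_V)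
    then show ?thesis by (auto simp: A_set_eq_V mem_V)
  qed
  with "3.IH" show ?case
    by (simp add: image_Un image_image append_coord_def flip: image_image[of "\<lambda>x. x @ _" rev])
qed auto

lemma D_rev_subset: "D_rev n \<subseteq> Z3_pow n"
  by (induction n rule: D_rev.induct) (auto simp: mem_V Z3_pow_def)

lemma Dlike_subset: "Dlike n s U \<Longrightarrow> U \<subseteq> Z3_pow n"
  by (induction rule: Dlike.induct) (auto simp: Z3_pow_def)

lemma Dlike_pos: "Dlike n s U \<Longrightarrow> n > 0"
  by (induction rule: Dlike.induct) auto

text \<open>The condition on sums strengthens the induction: the map that normalizes slice
  \<open>c\<close> then also carries the sum-class slices to class 0.\<close>

lemma Dlike_isometry:
  "Dlike n s U \<Longrightarrow> \<exists>\<sigma>. isometry n \<sigma> \<and> (\<forall>x\<in>Z3_pow n. sum_list (\<sigma> x) = sum_list x - s) \<and>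
     (\<forall>x\<in>Z3_pow n. x \<in> U \<longleftrightarrow> \<sigma> x \<in> D_rev n)"
proof (induction rule: Dlike.induct)
  case (base s)
  show ?case
    by (rule exI[of _ "map (\<lambda>b. b - s)"])
      (auto simp: isometry_def Z3_pow_def length_Suc_conv algebra_simps)
next
  case (step U n i s c)
  then obtain \<sigma> where \<sigma>: "isometry n \<sigma>"
    "\<And>x. length x = n \<Longrightarrow> sum_list (\<sigma> x) = sum_list x - (s - c)"
    "\<And>x. length x = n \<Longrightarrow> x \<in> slice i c U \<longleftrightarrow> \<sigma> x \<in> D_rev n"
    unfolding Z3_pow_def by blast
  obtain m where m: "n = Suc m" using Dlike_pos[OF step.hyps(3)] gr0_conv_Suc by blast
  \<comment> \<open>Moves coordinate \<open>i\<close> to the front, shifted so that the special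
    value \<open>c\<close> becomes 0, and applies \<open>\<sigma>\<close> to the rest.\<close>
  define \<tau> where "\<tau> z = (z ! i - c) # \<sigma> (take i z @ drop (Suc i) z)" for z
  have \<tau>: "\<tau> (ins i a y) = (a - c) # \<sigma> y" if "length y = n" for a y
    using that step.hyps(2) by (simp add: \<tau>_def ins_def nth_append min_def)
  have "isometry (Suc n) \<tau>"
    unfolding isometry_def
  proof (intro conjI allI impI)
    fix x :: "3 list" assume "length x = Suc n"
    then obtain a y where "x = ins i a y" "length y = n" using ins_exhaust step.hyps(2) by blast
    then show "length (\<tau> x) = Suc n" using \<sigma>(1) by (simp add: \<tau> isometry_def)
  next
    fix x x' :: "3 list" assume "length x = Suc n" "length x' = Suc n"
    then obtain a y a' y' where "x = ins i a y" "length y = n" "x' = ins i a' y'" "length y' = n"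
      using ins_exhaust step.hyps(2) by metis
    then show "hdist (\<tau> x) (\<tau> x') = hdist x x'" using \<sigma>(1) by (simp add: \<tau> isometry_def)
  qed
  moreover have "sum_list (\<tau> x) = sum_list x - s \<and> (x \<in> U \<longleftrightarrow> \<tau> x \<in> D_rev (Suc n))"
    if x: "x \<in> Z3_pow (Suc n)" for x
  proof -
    obtain a y where x: "x = ins i a y" and y: "length y = n"
      using ins_exhaust[OF _ step.hyps(2), of x] x unfolding Z3_pow_def by blast
    have len: "length (\<sigma> y) = n" using \<sigma>(1) y by (simp add: isometry_def)
    have "x \<in> U \<longleftrightarrow> \<tau> x \<in> D_rev (Suc n)"
    proof (cases "a = c")
      case True
      then show ?thesis using \<sigma>(3)[OF y] by (auto simp: x \<tau> y m)
    next
      case False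
      then have "x \<in> U \<longleftrightarrow> y \<in> V n (s - c)" using step.hyps(4)[of a] by (simp add: x set_eq_iff)
      also have "\<dots> \<longleftrightarrow> \<sigma> y \<in> V n 0" using \<sigma>(2)[OF y] len y by (simp add: mem_V)
      also have "\<dots> \<longleftrightarrow> \<tau> x \<in> D_rev (Suc n)"
      proof -
        have "a - c = 1 \<or> a - c = 2" "a - c \<noteq> 0" using False Z3_cases[of "a - c"] by auto
        then show ?thesis by (auto simp: x \<tau> y m)
      qed
      finally show ?thesis .
    qed
    moreover have "sum_list (\<tau> x) = sum_list x - s"
      using \<sigma>(2)[OF y] by (simp add: x \<tau> y algebra_simps)
    ultimately show ?thesis by blast
  qed
  ultimately show ?case by blast
qed

text \<open>In the special slice a neighbour exists by induction. The other two slices are the same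
  set, so each of their points is adjacent to its copy in the other one.\<close>

lemma Dlike_no_isolated: "Dlike n s U \<Longrightarrow> x \<in> U \<Longrightarrow> \<exists>y\<in>U. hdist x y = 1"
proof (induction arbitrary: x rule: Dlike.induct)
  case (step U n i s c)
  obtain a y where x: "x = ins i a y" and y: "length y = n"
    using ins_exhaust[OF _ step.hyps(2), of x] step.hyps(1) step.prems unfolding Z3_pow_def by blast
  show ?case
  proof (cases "a = c")
    case True
    then obtain z where z: "ins i c z \<in> U" "hdist y z = 1"
      using step.IH[of y] step.prems x by auto
    then have "length z = n" using length_slice[OF step.hyps(1)] by blast
    then show ?thesis using z True by (intro bexI[of _ "ins i c z"]) (simp_all add: x y)
  next
    case False
    obtain d where d: "d \<noteq> c" "d \<noteq> a" using Z3_neq_iff[of a c] False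
    proof -
      have "c + 1 \<noteq> c" "c + 2 \<noteq> c" "c + 1 \<noteq> c + 2" by simp_all
      then show ?thesis using that by metis
    qed
    have "y \<in> slice i a U" using step.prems x by simp
    then have "y \<in> slice i d U" using step.hyps(4) False d(1) by simp
    then show ?thesis using d(2) by (intro bexI[of _ "ins i d y"]) (simp_all add: x)
  qed
qed auto

section \<open>Large sets of maximum degree one\<close>

text \<open>The hypotheses on \<open>U\<close> apart from its size, with the independent set in
  normal form. The class \<open>s\<close> varies because slicing shifts it.\<close>

definition good :: "nat \<Rightarrow> 3 \<Rightarrow> 3 list set \<Rightarrow> bool" where
  "good n s U \<longleftrightarrow> U \<subseteq> Z3_pow n \<and> U \<inter> V n s = {} \<and> sparse U"

lemma good_slice:
  assumes "good (Suc n) s U"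
  shows "good n (s - c) (slice i c U)"
  unfolding good_def
proof (intro conjI)
  have U: "U \<subseteq> Z3_pow (Suc n)" using assms by (simp add: good_def)
  then show "slice i c U \<subseteq> Z3_pow n" by (rule slice_subset)
  show "slice i c U \<inter> V n (s - c) = {}"
    using assms by (auto simp: good_def mem_V)
  show "sparse (slice i c U)"
    unfolding sparse_def
  proof (intro ballI impI)
    fix x y z assume xyz: "x \<in> slice i c U" "y \<in> slice i c U" "z \<in> slice i c U"
      and h: "hdist x y = 1" "hdist x z = 1"
    have len: "length x = n" "length y = n" "length z = n" using xyz length_slice[OF U] by simp_all
    have "hdist (ins i c x) (ins i c y) = 1" "hdist (ins i c x) (ins i c z) = 1"
      using h len by simp_all
    then have "ins i c y = ins i c z"
      using assms xyz unfolding good_def sparse_def by (metis mem_slice)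
    then show "y = z" using len by (simp add: ins_eq_iff)
  qed
qed

text \<open>A common point, placed in slice \<open>c\<close>, would have one neighbour inside that
  slice by \<open>Dlike_no_isolated\<close> and a second one in slice \<open>d\<close>.\<close>

lemma Dlike_slice_disjnt:
  assumes "good (Suc n) s U" "Dlike n r (slice i c U)" "d \<noteq> c"
  shows "slice i d U \<inter> slice i c U = {}"
proof (rule ccontr)
  assume "slice i d U \<inter> slice i c U \<noteq> {}"
  then obtain x where x: "ins i d x \<in> U" "ins i c x \<in> U" by auto
  then obtain y where y: "ins i c y \<in> U" "hdist x y = 1"
    using Dlike_no_isolated[OF assms(2), of x] by auto
  have U: "U \<subseteq> Z3_pow (Suc n)" using assms by (simp add: good_def)
  have len: "length x = n" "length y = n" using x y length_slice[OF U] by blast+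
  have "hdist (ins i c x) (ins i d x) = 1" "hdist (ins i c x) (ins i c y) = 1"
    using y(2) len assms(3) by simp_all
  then have "ins i d x = ins i c y"
    using assms(1) x y unfolding good_def sparse_def by blast
  then show False using assms(3) len by (simp add: ins_eq_iff)
qed

text \<open>The induction claim for dimension \<open>m + 1\<close>; the shift avoids subtraction in
  the exponent.\<close>

definition unique_at :: "nat \<Rightarrow> bool" where
  "unique_at m \<longleftrightarrow> (\<forall>s U. good (Suc m) s U \<longrightarrow> 3 ^ m < card U \<longrightarrow>
     card U = 3 ^ m + 1 \<and> Dlike (Suc m) s U)"

lemma unique_atD:
  assumes "unique_at m" "good (Suc m) s U" "3 ^ m < card U"
  shows "card U = 3 ^ m + 1" "Dlike (Suc m) s U"
  using assms unfolding unique_at_def by blast+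

lemma unique_at_card_le:
  assumes "unique_at m" "good (Suc m) s U"
  shows "card U \<le> 3 ^ m + 1"
  using unique_atD(1)[OF assms] by linarith

lemma finite_good: "good n s U \<Longrightarrow> finite U"
  using finite_Z3_pow finite_subset unfolding good_def by blast

text \<open>Two slices of excess one would both be disjoint from everything else, so that the three
  slices together would not fit into the space.\<close>

lemma main_slice:
  assumes "unique_at m" "good (Suc (Suc m)) s U" "3 ^ Suc m < card U" "i \<le> Suc m"
  shows "card U = 3 ^ Suc m + 1"
    and "\<exists>c. card (slice i c U) = 3 ^ m + 1 \<and> Dlike (Suc m) (s - c) (slice i c U) \<and>
      (\<forall>d. d \<noteq> c \<longrightarrow> card (slice i d U) = 3 ^ m \<and> slice i d U \<inter> slice i c U = {})"
proof -
  have U: "U \<subseteq> Z3_pow (Suc (Suc m))" using assms(2) by (simp add: good_def)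
  note g = good_slice[OF assms(2), of _ i]
  note sum = card_slices[OF U assms(4)]
  note le = unique_at_card_le[OF assms(1) g]
  have "\<exists>c. 3 ^ m < card (slice i c U)"
  proof (rule ccontr)
    assume "\<nexists>c. 3 ^ m < card (slice i c U)"
    then have "card (slice i c U) \<le> 3 ^ m" for c by (simp add: not_less)
    from this[of 0] this[of "0 + 1"] this[of "0 + 2"] sum[of 0] assms(3) show False by simp
  qed
  then obtain c where c: "3 ^ m < card (slice i c U)" by blast
  note Dc = unique_atD[OF assms(1) g c]
  have le': "card (slice i d U) \<le> 3 ^ m" if "d \<noteq> c" for d
  proof (rule ccontr)
    assume "\<not> card (slice i d U) \<le> 3 ^ m"
    then have d: "3 ^ m < card (slice i d U)" by simp
    note Dd = unique_atD[OF assms(1) g d]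
    obtain e where e: "e \<noteq> c" "e \<noteq> d" and cde: "card U = card (slice i c U) + card (slice i d U) + card (slice i e U)"
    proof (cases "d = c + 1")
      case True
      then show ?thesis using that[of "c + 2"] sum[of c] by simp
    next
      case False
      then have "d = c + 2" using \<open>d \<noteq> c\<close> Z3_neq_iff by blast
      then show ?thesis using that[of "c + 1"] sum[of c] by simp
    qed
    let ?C = "slice i c U" and ?D = "slice i d U" and ?E = "slice i e U"
    have disj: "?D \<inter> ?C = {}" "?E \<inter> ?C = {}" "?E \<inter> ?D = {}"
      using that e Dlike_slice_disjnt[OF assms(2)] Dc(2) Dd(2) by blast+
    have "card (?C \<union> ?D \<union> ?E) = card ?C + card ?D + card ?E"
      using disj finite_good[OF g] by (subst card_Un_disjoint; auto simp: card_Un_disjoint Int_commute simp del: mem_slice)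
    moreover have "card (?C \<union> ?D \<union> ?E) \<le> card (Z3_pow (Suc m))"
      using slice_subset[OF U] by (intro card_mono) auto
    ultimately show False using cde assms(3) by (simp add: card_Z3_pow)
  qed
  have "c + 1 \<noteq> c" "c + 2 \<noteq> c" by simp_all
  note le'' = le'[OF this(1)] le'[OF this(2)]
  \<comment> \<open>The total is at least \<open>3 * 3 ^ m + 1\<close> and the large slice has
    \<open>3 ^ m + 1\<close> points, so the other two attain their bounds.\<close>
  have eq: "card (slice i (c + 1) U) = 3 ^ m" "card (slice i (c + 2) U) = 3 ^ m"
    "card U = 3 ^ Suc m + 1"
    using sum[of c] le'' Dc(1) assms(3) by simp_all
  show "card U = 3 ^ Suc m + 1" by fact
  have "card (slice i d U) = 3 ^ m \<and> slice i d U \<inter> slice i c U = {}" if "d \<noteq> c" for d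
    using that eq Z3_neq_iff Dlike_slice_disjnt[OF assms(2) Dc(2) that] by metis
  with Dc show "\<exists>c. card (slice i c U) = 3 ^ m + 1 \<and> Dlike (Suc m) (s - c) (slice i c U) \<and>
      (\<forall>d. d \<noteq> c \<longrightarrow> card (slice i d U) = 3 ^ m \<and> slice i d U \<inter> slice i c U = {})"
    by blast
qed

text \<open>Two slices of size \<open>3 ^ m\<close> leave more than \<open>3 ^ m\<close> points to
  the third, to which the claim one dimension lower applies.\<close>

lemma Dlike_if_two_slices:
  assumes "unique_at m" "good (Suc (Suc m)) s U" "3 ^ Suc m < card U" "i \<le> Suc m"
    and "\<And>d. d \<noteq> c \<Longrightarrow> slice i d U = V (Suc m) (s - c)"
  shows "Dlike (Suc (Suc m)) s U"
proof -
  have U: "U \<subseteq> Z3_pow (Suc (Suc m))" using assms(2) by (simp add: good_def)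
  have "card (slice i d U) = 3 ^ m" if "d \<noteq> c" for d
    using assms(5)[OF that] by (simp add: card_V)
  from this[of "c + 1"] this[of "c + 2"] have "3 ^ m < card (slice i c U)"
    using card_slices[OF U assms(4), of c] assms(3) by simp
  then have "Dlike (Suc m) (s - c) (slice i c U)"
    by (rule unique_atD(2)[OF assms(1) good_slice[OF assms(2)]])
  with U assms(4) show ?thesis using assms(5) by (rule Dlike.step)
qed

section \<open>Dimensions one and two\<close>

lemma unique_at_0: "unique_at 0"
  unfolding unique_at_def
proof (intro allI impI)
  fix s U assume g: "good (Suc 0) s U" and card: "3 ^ 0 < card U"
  have "U \<subseteq> {[s + 1], [s + 2]}"
  proof
    fix x assume x: "x \<in> U"
    then obtain a where a: "x = [a]" using g by (auto simp: good_def Z3_pow_def length_Suc_conv)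
    have "a \<noteq> s" using g x a by (auto simp: good_def mem_V)
    then show "x \<in> {[s + 1], [s + 2]}" using a Z3_neq_iff by auto
  qed
  moreover have "card {[s + 1], [s + 2]} = 2" by simp
  ultimately have "U = {[s + 1], [s + 2]}"
    using card by (intro card_seteq) auto
  then show "card U = 3 ^ 0 + 1 \<and> Dlike (Suc 0) s U" using Dlike.base[of s] by simp
qed

text \<open>The large slice has two points and avoids the point of sum \<open>s - c\<close>, so
  together they fill the line. Every other slice is a single point outside the large slice, hence
  that remaining point.\<close>

lemma unique_at_1: "unique_at (Suc 0)"
  unfolding unique_at_def
proof (intro allI impI)
  fix s U assume g: "good (Suc (Suc 0)) s U" and card: "3 ^ Suc 0 < card U"
  obtain c where c: "card (slice 0 c U) = 3 ^ 0 + 1" "Dlike (Suc 0) (s - c) (slice 0 c U)"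
    "\<And>d. d \<noteq> c \<Longrightarrow> card (slice 0 d U) = 3 ^ 0"
    "\<And>d. d \<noteq> c \<Longrightarrow> slice 0 d U \<inter> slice 0 c U = {}"
    using main_slice(2)[OF unique_at_0 g card, of 0] by auto
  have "slice 0 d U = V (Suc 0) (s - c)" if d: "d \<noteq> c" for d
  proof -
    have U: "U \<subseteq> Z3_pow (Suc (Suc 0))" using g by (simp add: good_def)
    have sub: "slice 0 c U \<subseteq> - V (Suc 0) (s - c)"
      using good_slice[OF g, of c 0] unfolding good_def by blast
    have "V (Suc 0) (s - c) \<union> slice 0 c U = Z3_pow (Suc 0)"
    proof (rule card_subset_eq)
      show "V (Suc 0) (s - c) \<union> slice 0 c U \<subseteq> Z3_pow (Suc 0)"
        using V_subset slice_subset[OF U] by blast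
      have "card (V (Suc 0) (s - c) \<union> slice 0 c U) = card (V (Suc 0) (s - c)) + card (slice 0 c U)"
        using sub finite_good[OF good_slice[OF g]] by (intro card_Un_disjoint) auto
      then show "card (V (Suc 0) (s - c) \<union> slice 0 c U) = card (Z3_pow (Suc 0))"
        using c(1) by (simp add: card_Z3_pow card_V)
    qed simp
    then have "slice 0 d U \<subseteq> V (Suc 0) (s - c)"
      using c(4)[OF d] slice_subset[OF U, of 0 d] by blast
    then show ?thesis using c(3)[OF d] by (intro card_subset_eq) (simp_all add: card_V)
  qed
  then have "Dlike (Suc (Suc 0)) s U"
    using Dlike_if_two_slices[OF unique_at_0 g card, of 0 c] by simp
  then show "card U = 3 ^ Suc 0 + 1 \<and> Dlike (Suc (Suc 0)) s U" using main_slice(1)[OF unique_at_0 g card, of 0] by simp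
qed

text \<open>Writing the residues as \<open>0\<close>, \<open>e\<close>, \<open>- e\<close> treats
  the two nonzero grid indices symmetrically.\<close>

lemma Z3_multiples:
  assumes "(e::3) \<noteq> 0"
  shows "x = 0 \<or> x = e \<or> x = - e" "e + e = - e" "- e \<noteq> e" "- e \<noteq> 0"
  using Z3_cases[of e] Z3_cases[of x] assms by (elim disjE; simp)+

section \<open>Slicing in two directions\<close>

locale grid =
  \<comment> \<open>Rows are slices in the head coordinate, and columns are slices in coordinate j of the tail,
    that is, coordinate Suc j of the whole vector. Both are shifted so that index 0 is the large row
    and the large slice of that row.\<close>
  fixes l :: nat and s r0 c0 :: 3 and j :: nat and U :: "3 list set"
  assumes good_U: "good (Suc (Suc (Suc l))) s U"
    and j: "j \<le> Suc l"
    and row0: "\<And>c. c \<noteq> c0 \<Longrightarrow> slice j c (slice 0 r0 U) = V (Suc l) (s - r0 - c0)"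
begin

definition W :: "3 \<Rightarrow> 3 \<Rightarrow> 3 list set" where
  "W a b = slice j (c0 + b) (slice 0 (r0 + a) U)"

text \<open>The class that \<open>W 0 0\<close> avoids, which also fills each other entry of row
  0.\<close>

definition t :: 3 where
  "t = s - r0 - c0"

lemma mem_W: "y \<in> W a b \<longleftrightarrow> (r0 + a) # ins j (c0 + b) y \<in> U"
  by (simp add: W_def)

text \<open>Slicing in the two directions commutes, so facts about slices apply to columns as well
  as to rows.\<close>

lemma W_eq_slice_column: "W a b = slice 0 (r0 + a) (slice (Suc j) (c0 + b) U)"
  by (auto simp: W_def)

lemma U_subset: "U \<subseteq> Z3_pow (Suc (Suc (Suc l)))"
  using good_U by (simp add: good_def)

lemma good_W: "good (Suc l) (t - a - b) (W a b)"
proof -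
  have "good (Suc l) (s - (r0 + a) - (c0 + b)) (W a b)"
    unfolding W_def by (intro good_slice good_U)
  moreover have "s - (r0 + a) - (c0 + b) = t - a - b"
    by (simp add: t_def algebra_simps)
  ultimately show ?thesis by simp
qed

lemma W_subset: "W a b \<subseteq> Z3_pow (Suc l)"
  using good_W by (simp add: good_def)

lemma length_W: "y \<in> W a b \<Longrightarrow> length y = Suc l"
  using W_subset by (auto simp: Z3_pow_def)

lemma W_avoids: "y \<in> W a b \<Longrightarrow> sum_list y \<noteq> t - a - b"
  using good_W[of a b] length_W by (auto simp: good_def mem_V)

lemma finite_W: "finite (W a b)"
  using good_W by (rule finite_good)

lemma W_0: "b \<noteq> 0 \<Longrightarrow> W 0 b = V (Suc l) t"
  using row0[of "c0 + b"] by (simp add: W_def t_def)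

text \<open>The distance in \<open>U\<close> is the number of differing grid indices plus the
  distance of the remaining coordinates; the numerical hypotheses say that it is 1.\<close>

lemma W_unique_neighbour:
  assumes "y \<in> W a b" "y1 \<in> W a1 b1" "y2 \<in> W a2 b2"
    and "(if a = a1 then 0 else 1) + (if b = b1 then 0 else 1) + hdist y y1 = (1::nat)"
    and "(if a = a2 then 0 else 1) + (if b = b2 then 0 else 1) + hdist y y2 = (1::nat)"
  shows "a1 = a2 \<and> b1 = b2 \<and> y1 = y2"
proof -
  let ?p = "\<lambda>a b y. (r0 + a) # ins j (c0 + b) y"
  note len = length_W[OF assms(1)] length_W[OF assms(2)] length_W[OF assms(3)]
  have "hdist (?p a b y) (?p a1 b1 y1) = 1" "hdist (?p a b y) (?p a2 b2 y2) = 1"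
    using assms(4,5) len by (simp_all add: ac_simps)
  then have "?p a1 b1 y1 = ?p a2 b2 y2"
    using good_U assms(1-3) unfolding good_def sparse_def mem_W by blast
  then show ?thesis using len by (simp add: ins_eq_iff)
qed

text \<open>The point \<open>y\<close> of \<open>W a b\<close> would have two neighbours, one along
  its column and one along its row.\<close>

lemma W_corner:
  assumes "y \<in> W a b" "y \<in> W a' b" "y \<in> W a b'" "a \<noteq> a'" "b \<noteq> b'"
  shows False
  using W_unique_neighbour[OF assms(1-3)] assms(4,5) by simp

text \<open>Class \<open>t - e - e = t + e\<close> is avoided. A point of class \<open>t\<close>
  would also lie in \<open>W 0 e\<close> and \<open>W 0 (- e)\<close>, giving a corner at
  \<open>W 0 e\<close>. Only \<open>t - e\<close> remains.\<close>

lemma W_diag_subset: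
  assumes e: "e \<noteq> 0"
  shows "W e e \<subseteq> V (Suc l) (t - e)"
proof
  fix y assume y: "y \<in> W e e"
  note len = length_W[OF y]
  have "sum_list y \<noteq> t"
  proof
    assume "sum_list y = t"
    then have "y \<in> W 0 e" "y \<in> W 0 (- e)"
      using W_0 Z3_multiples(4)[OF e] e len by (simp_all add: mem_V)
    then show False using W_corner[OF _ y, of 0 "- e"] Z3_multiples(3)[OF e] e by auto
  qed
  moreover have "sum_list y \<noteq> t + e"
  proof -
    have eq: "t - e - e = t + e" unfolding diff_diff_eq Z3_multiples(2)[OF e] by simp
    show ?thesis using W_avoids[OF y] unfolding eq .
  qed
  ultimately have "sum_list y = t - e"
    using Z3_multiples(1)[OF e, of "sum_list y - t"] by (auto simp: algebra_simps)
  then show "y \<in> V (Suc l) (t - e)" using len by (simp add: mem_V)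
qed

lemma card_W_diag_le: "e \<noteq> 0 \<Longrightarrow> card (W e e) \<le> 3 ^ l"
  using card_mono[OF finite_V W_diag_subset] by (simp add: card_V)

lemma W_column_disjnt:
  assumes "Dlike (Suc l) r (W a b)" "a' \<noteq> a"
  shows "W a' b \<inter> W a b = {}"
  unfolding W_eq_slice_column
proof (rule Dlike_slice_disjnt)
  show "good (Suc (Suc l)) (s - (c0 + b)) (slice (Suc j) (c0 + b) U)"
    by (rule good_slice[OF good_U])
  show "Dlike (Suc l) r (slice 0 (r0 + a) (slice (Suc j) (c0 + b) U))"
    using assms(1) by (simp add: W_eq_slice_column)
qed (use assms(2) in simp)

lemma W_row_disjnt:
  assumes "Dlike (Suc l) r (W a b)" "b' \<noteq> b"
  shows "W a b' \<inter> W a b = {}"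
  unfolding W_def
proof (rule Dlike_slice_disjnt)
  show "good (Suc (Suc l)) (s - (r0 + a)) (slice 0 (r0 + a) U)"
    by (rule good_slice[OF good_U])
  show "Dlike (Suc l) r (slice j (c0 + b) (slice 0 (r0 + a) U))"
    using assms(1) by (simp add: W_def)
qed (use assms(2) in simp)

text \<open>In a large column \<open>e\<close>, the entries \<open>W 0 e\<close> and
  \<open>W e e\<close> are too small to be the large one, so it is \<open>W (- e) e\<close>. The
  other two then have full size and are the classes \<open>t\<close> and \<open>t - e\<close>. Being
  disjoint from both, the large entry is confined to class \<open>t + e\<close>, which is too
  small.\<close>

lemma column_not_main:
  assumes l: "unique_at l" and e: "e \<noteq> 0"
  shows "card (slice (Suc j) (c0 + e) U) \<le> 3 ^ Suc l"
proof (rule ccontr)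
  assume "\<not> card (slice (Suc j) (c0 + e) U) \<le> 3 ^ Suc l"
  then have card: "3 ^ Suc l < card (slice (Suc j) (c0 + e) U)" by simp
  obtain r where r: "card (slice 0 r (slice (Suc j) (c0 + e) U)) = 3 ^ l + 1"
    "Dlike (Suc l) (s - (c0 + e) - r) (slice 0 r (slice (Suc j) (c0 + e) U))"
    "\<And>d. d \<noteq> r \<Longrightarrow> card (slice 0 d (slice (Suc j) (c0 + e) U)) = 3 ^ l"
    using main_slice(2)[OF l good_slice[OF good_U] card le0] by blast
  define a where "a = r - r0"
  have ra: "r = r0 + a" by (simp add: a_def)
  have a: "card (W a e) = 3 ^ l + 1" "Dlike (Suc l) (s - (c0 + e) - r) (W a e)"
    "\<And>a'. a' \<noteq> a \<Longrightarrow> card (W a' e) = 3 ^ l"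
    using r unfolding ra W_eq_slice_column by simp_all
  have "card (W 0 e) = 3 ^ l" using W_0[OF e] by (simp add: card_V)
  then have "a \<noteq> 0" using a(1) by auto
  moreover have "a \<noteq> e" using a(1) card_W_diag_le[OF e] by auto
  ultimately have a_eq: "a = - e" using Z3_multiples(1)[OF e, of a] by blast
  have "W e e = V (Suc l) (t - e)"
    using W_diag_subset[OF e] a(3)[OF \<open>a \<noteq> e\<close>[symmetric]]
    by (intro card_subset_eq) (simp_all add: card_V)
  then have disj: "V (Suc l) (t - e) \<inter> W a e = {}" "V (Suc l) t \<inter> W a e = {}"
    using W_column_disjnt[OF a(2), of e] W_column_disjnt[OF a(2), of 0] \<open>a \<noteq> 0\<close> \<open>a \<noteq> e\<close> W_0[OF e]
    by simp_all
  have "W a e \<subseteq> V (Suc l) (t + e)"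
  proof
    fix y assume y: "y \<in> W a e"
    note len = length_W[OF y]
    have "sum_list y \<noteq> t" "sum_list y \<noteq> t - e" using disj y len by (auto simp: mem_V)
    then have "sum_list y = t + e"
      using Z3_multiples(1)[OF e, of "sum_list y - t"] by (auto simp: algebra_simps)
    then show "y \<in> V (Suc l) (t + e)" using len by (simp add: mem_V)
  qed
  then have "card (W a e) \<le> 3 ^ l" using card_mono[OF finite_V] card_V by metis
  then show False using a(1) by simp
qed

text \<open>Adding the column coordinate \<open>c0 + b\<close> to the sum \<open>t - b\<close> gives
  \<open>s - r0\<close> in every entry, so a small row glues to one class.\<close>

lemma Dlike_if_rows:
  assumes "unique_at (Suc l)" "3 ^ Suc (Suc l) < card U"
    and W: "\<And>a b. a \<noteq> 0 \<Longrightarrow> W a b = V (Suc l) (t - b)"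
  shows "Dlike (Suc (Suc (Suc l))) s U"
proof (rule Dlike_if_two_slices[OF assms(1) good_U assms(2), of 0 r0])
  fix d assume "d \<noteq> r0"
  then have a: "d - r0 \<noteq> 0" by simp
  show "slice 0 d U = V (Suc (Suc l)) (s - r0)"
  proof (rule set_eqI)
    fix z
    show "z \<in> slice 0 d U \<longleftrightarrow> z \<in> V (Suc (Suc l)) (s - r0)"
    proof (cases "length z = Suc (Suc l)")
      case True
      then obtain c y where z: "z = ins j c y" "length y = Suc l" using ins_exhaust j by blast
      have "z \<in> slice 0 d U \<longleftrightarrow> y \<in> W (d - r0) (c - c0)" by (simp add: mem_W z)
      also have "\<dots> \<longleftrightarrow> z \<in> V (Suc (Suc l)) (s - r0)"
        unfolding W[OF a] by (auto simp: mem_V z t_def algebra_simps)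
      finally show ?thesis .
    next
      case False
      then show ?thesis using slice_subset[OF U_subset, of 0 d] by (auto simp: mem_V Z3_pow_def)
    qed
  qed
qed simp

text \<open>Here the row coordinate \<open>r0 + a\<close> and the sum \<open>t - a\<close> add up to
  \<open>s - c0\<close>.\<close>

lemma Dlike_if_columns:
  assumes "unique_at (Suc l)" "3 ^ Suc (Suc l) < card U"
    and W: "\<And>a b. b \<noteq> 0 \<Longrightarrow> W a b = V (Suc l) (t - a)"
  shows "Dlike (Suc (Suc (Suc l))) s U"
proof (rule Dlike_if_two_slices[OF assms(1) good_U assms(2), of "Suc j" c0])
  fix d assume "d \<noteq> c0"
  then have b: "d - c0 \<noteq> 0" by simp
  show "slice (Suc j) d U = V (Suc (Suc l)) (s - c0)"
  proof (rule set_eqI)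
    fix z
    show "z \<in> slice (Suc j) d U \<longleftrightarrow> z \<in> V (Suc (Suc l)) (s - c0)"
    proof (cases "length z = Suc (Suc l)")
      case True
      then obtain u y where z: "z = u # y" "length y = Suc l" by (auto simp: length_Suc_conv)
      have "z \<in> slice (Suc j) d U \<longleftrightarrow> y \<in> W (u - r0) (d - c0)" by (simp add: mem_W z)
      also have "\<dots> \<longleftrightarrow> z \<in> V (Suc (Suc l)) (s - c0)"
        unfolding W[OF b] by (auto simp: mem_V z t_def algebra_simps)
      finally show ?thesis .
    next
      case False
      then show ?thesis using slice_subset[OF U_subset, of "Suc j" d] by (auto simp: mem_V Z3_pow_def)
    qed
  qed
qed (use j in simp)

end

section \<open>Counting the grid entries\<close>

locale full_grid = grid +
  assumes unique_l: "unique_at l" and unique_Suc_l: "unique_at (Suc l)"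
    and card_U: "3 ^ Suc (Suc l) < card U"
    and Dlike_W00: "Dlike (Suc l) t (W 0 0)"
    and card_row0: "card (slice 0 r0 U) = 3 ^ Suc l + 1"
    and card_row: "\<And>d. d \<noteq> r0 \<Longrightarrow> card (slice 0 d U) = 3 ^ Suc l"
begin

lemma card_rowsum:
  assumes e: "e \<noteq> 0"
  shows "card (slice 0 (r0 + a) U) = card (W a 0) + card (W a e) + card (W a (- e))"
proof -
  have *: "card (slice 0 (r0 + a) U) = card (W a 0) + card (W a 1) + card (W a 2)"
    using card_slices[OF slice_subset[OF U_subset] j, of 0 "r0 + a" c0] by (simp add: W_def)
  have "e = 1 \<and> - e = 2 \<or> e = 2 \<and> - e = 1" using Z3_cases[of e] e by (elim disjE) (simp_all add: Z3_arith)
  then show ?thesis using * by (elim disjE conjE) (simp_all only: ac_simps)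
qed

lemma card_colsum:
  assumes e: "e \<noteq> 0"
  shows "card (slice (Suc j) (c0 + b) U) = card (W 0 b) + card (W e b) + card (W (- e) b)"
proof -
  have *: "card (slice (Suc j) (c0 + b) U) = card (W 0 b) + card (W 1 b) + card (W 2 b)"
    using card_slices[OF slice_subset[OF U_subset], of 0 "Suc j" "c0 + b" r0]
    by (simp add: W_eq_slice_column)
  have "e = 1 \<and> - e = 2 \<or> e = 2 \<and> - e = 1" using Z3_cases[of e] e by (elim disjE) (simp_all add: Z3_arith)
  then show ?thesis using * by (elim disjE conjE) (simp_all only: ac_simps)
qed

lemma card_W00: "card (W 0 0) = 3 ^ l + 1"
  using card_rowsum[of 1 0] card_row0 W_0[of 1] W_0[of "- 1"] by (simp add: card_V)

text \<open>\<open>main_slice\<close> yields one large column, which \<open>column_not_main\<close>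
  identifies as \<open>c0\<close>.\<close>

lemma card_columns:
  "card (slice (Suc j) c0 U) = 3 ^ Suc l + 1"
  "b \<noteq> 0 \<Longrightarrow> card (slice (Suc j) (c0 + b) U) = 3 ^ Suc l"
proof -
  obtain c where c: "card (slice (Suc j) c U) = 3 ^ Suc l + 1"
    "\<And>d. d \<noteq> c \<Longrightarrow> card (slice (Suc j) d U) = 3 ^ Suc l"
    using main_slice(2)[OF unique_Suc_l good_U card_U, of "Suc j"] j by auto
  have "c = c0"
  proof (rule ccontr)
    assume "c \<noteq> c0"
    then show False using column_not_main[OF unique_l, of "c - c0"] c(1) by simp
  qed
  then show "card (slice (Suc j) c0 U) = 3 ^ Suc l + 1"
    "b \<noteq> 0 \<Longrightarrow> card (slice (Suc j) (c0 + b) U) = 3 ^ Suc l" using c by auto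
qed

text \<open>Column \<open>c0\<close> is itself large, so \<open>main_slice\<close> applies within
  it; its large entry is \<open>W 0 0\<close> by \<open>card_W00\<close>.\<close>

lemma card_W_col0:
  assumes "a \<noteq> 0"
  shows "card (W a 0) = 3 ^ l"
proof -
  have card: "3 ^ Suc l < card (slice (Suc j) c0 U)" using card_columns(1) by simp
  obtain r where r: "card (slice 0 r (slice (Suc j) c0 U)) = 3 ^ l + 1"
    "\<And>d. d \<noteq> r \<Longrightarrow> card (slice 0 d (slice (Suc j) c0 U)) = 3 ^ l"
    using main_slice(2)[OF unique_l good_slice[OF good_U] card le0] by blast
  have W: "W a 0 = slice 0 (r0 + a) (slice (Suc j) c0 U)" for a
    by (simp add: W_eq_slice_column)
  have "r = r0"
  proof (rule ccontr)
    assume "r \<noteq> r0"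
    then have "card (W 0 0) = 3 ^ l" using r(2)[of r0] W[of 0] by simp
    then show False using card_W00 by simp
  qed
  then show ?thesis using r(2)[of "r0 + a"] W assms by simp
qed

text \<open>Row and column \<open>e\<close> each total \<open>3 ^ Suc l\<close>, of which
  \<open>W e 0\<close> and \<open>W 0 e\<close> account for \<open>3 ^ l\<close>.\<close>

lemma card_W_diag:
  assumes e: "e \<noteq> 0"
  shows "card (W e e) + card (W e (- e)) = 2 * 3 ^ l" "card (W e e) + card (W (- e) e) = 2 * 3 ^ l"
  using card_rowsum[OF e, of e] card_row[of "r0 + e"] card_colsum[OF e, of e] card_columns(2)[OF e]
    card_W_col0[OF e] W_0[OF e] e by (simp_all add: card_V)

end

section \<open>Deficient and full diagonal entries\<close>

context full_grid
begin

text \<open>A deficient diagonal entry makes its neighbour in the row a copy of $D_{l+1}$ that contains a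
  whole sum class and one further point; that point has $l+1$ neighbours in the class, whence
  $l = 0$.\<close>

lemma small_diag:
  assumes e: "e \<noteq> 0" and small: "card (W e e) < 3 ^ l"
  shows "l = 0 \<and> W e 0 = V (Suc l) t \<and> card (W e (- e)) = 3 ^ l + 1"
proof -
  have gf: "good (Suc l) t (W e (- e))" using good_W[of e "- e"] by simp
  have "3 ^ l < card (W e (- e))" using card_W_diag(1)[OF e] small by linarith
  note f = unique_atD[OF unique_l gf this]
  have card_e: "card (W e e) + 1 = 3 ^ l" using f(1) card_W_diag(1)[OF e] by simp
  have "- e \<noteq> e" "- e \<noteq> 0" using Z3_multiples[OF e] by blast+
  then have disj: "W e e \<inter> W e (- e) = {}" "W e 0 \<inter> W e (- e) = {}"
    using W_row_disjnt[OF f(2), of e] W_row_disjnt[OF f(2), of 0] by simp_all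
  have disj': "W e 0 \<inter> W e e = {}"
    using W_diag_subset[OF e] W_avoids[of _ e 0] by (auto simp: mem_V)
  \<comment> \<open>The entries of row \<open>e\<close> are disjoint and have sizes
    \<open>3 ^ l\<close>, \<open>3 ^ l - 1\<close> and \<open>3 ^ l + 1\<close>, so they fill the
    space.\<close>
  have "card (W e 0 \<union> W e e \<union> W e (- e)) = card (W e 0 \<union> W e e) + card (W e (- e))"
    using disj finite_W by (intro card_Un_disjoint) (auto simp: Int_Un_distrib2)
  also have "card (W e 0 \<union> W e e) = card (W e 0) + card (W e e)"
    using disj' finite_W by (intro card_Un_disjoint) auto
  finally have "card (W e 0 \<union> W e e \<union> W e (- e)) = card (Z3_pow (Suc l))"
    using f(1) card_e card_W_col0[OF e] by (simp add: card_Z3_pow)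
  then have all: "W e 0 \<union> W e e \<union> W e (- e) = Z3_pow (Suc l)"
    using W_subset by (intro card_subset_eq) auto
  \<comment> \<open>Class \<open>t\<close> misses \<open>W e e\<close>, which lies in class
    \<open>t - e\<close>, and \<open>W e (- e)\<close>, which avoids \<open>t\<close>.\<close>
  have "V (Suc l) t \<subseteq> W e 0"
  proof
    fix y assume y: "y \<in> V (Suc l) t"
    then have "y \<notin> W e e" using W_diag_subset[OF e] e by (auto simp: mem_V)
    moreover have "y \<notin> W e (- e)" using y gf by (auto simp: good_def)
    ultimately show "y \<in> W e 0" using y V_subset all by blast
  qed
  then have We0: "V (Suc l) t = W e 0"
    using card_W_col0[OF e] finite_W by (intro card_subset_eq) (simp_all add: card_V)
  have upper: "V (Suc l) (t + e) \<subseteq> W e (- e)"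
  proof
    fix y assume y: "y \<in> V (Suc l) (t + e)"
    have "t + e \<noteq> t - e"
      using Z3_multiples(3)[OF e] by (metis add_left_cancel diff_conv_add_uminus)
    then have "y \<notin> W e e" using y W_diag_subset[OF e] by (auto simp: mem_V)
    moreover have "y \<notin> W e 0" using y e unfolding We0[symmetric] by (simp add: mem_V)
    ultimately show "y \<in> W e (- e)" using y V_subset all by blast
  qed
  \<comment> \<open>\<open>W e (- e)\<close> has one point more than a sum class.\<close>
  have "\<not> W e (- e) \<subseteq> V (Suc l) (t + e)"
    using card_mono[OF finite_V, of "W e (- e)" "Suc l" "t + e"] f(1) by (auto simp: card_V)
  then obtain v where "v \<in> W e (- e)" "v \<notin> V (Suc l) (t + e)" by blast
  then have v: "v \<in> W e (- e)" "sum_list v \<noteq> t + e" "length v = Suc l"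
    using length_W by (auto simp: mem_V)
  have "sum_list v \<noteq> t" using v(1) We0 disj(2) v(3) by (auto simp: mem_V)
  then have sum_v: "sum_list v = t - e"
    using v(2) Z3_multiples(1)[OF e, of "sum_list v - t"] by (auto simp: algebra_simps)
  have "l = 0"
  proof (rule ccontr)
    assume "l \<noteq> 0"
    then obtain a b w where w: "v = a # b # w"
      using v(3) by (cases v; cases "tl v") auto
    have "t - e - e = t + e" unfolding diff_diff_eq Z3_multiples(2)[OF e] by simp
    then have "sum_list v - e = t + e" using sum_v by (simp only:)
    then have sum_w: "a - e + b + sum_list w = t + e" "a + (b - e) + sum_list w = t + e"
      by (simp_all add: w algebra_simps)
    \<comment> \<open>Lowering either of the first two coordinates of \<open>v\<close> by
      \<open>e\<close> reaches class \<open>t + e\<close>, which gives \<open>v\<close> two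
      neighbours in its own entry.\<close>
    have "(a - e) # b # w \<in> W e (- e)" "a # (b - e) # w \<in> W e (- e)"
      using sum_w v(3) by (auto intro!: upper[THEN subsetD] simp: mem_V w add.assoc)
    from W_unique_neighbour[OF v(1) this] e show False by (simp add: w)
  qed
  then show ?thesis using We0 f(1) by simp
qed

text \<open>In dimension three neither grid direction need be one in which the two small slices are sum
  classes, so the remaining coordinate i is used.\<close>

lemma Dlike_if_small_diag:
  assumes e: "e \<noteq> 0" and small: "card (W e e) < 3 ^ l"
  shows "Dlike (Suc (Suc (Suc l))) s U"
proof -
  let ?f = "- e"
  have f: "?f \<noteq> 0" "?f \<noteq> e" "- ?f = e" "e + e \<noteq> 0" "?f + ?f \<noteq> 0"
    using Z3_multiples[OF e] Z3_multiples[of "- e"] e by auto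
  note se = small_diag[OF e small]
  then have l: "l = 0" by blast
  \<comment> \<open>The surplus point of \<open>W e (- e)\<close> makes the diagonal entry of column
    \<open>- e\<close> deficient too, so \<open>small_diag\<close> applies to both signs.\<close>
  have "card (W ?f ?f) < 3 ^ l"
    using card_W_diag(2)[OF f(1)] se by (simp add: f(3))
  note sf = small_diag[OF f(1) this, unfolded f(3)]
  have We: "W e e = {}" "W ?f ?f = {}"
    using small \<open>card (W ?f ?f) < 3 ^ l\<close> finite_W l by simp_all
  have full: "[x] \<in> W a b" if "card (W a b) = 3 ^ l + 1" "a + b = 0" "x \<noteq> t" for a b x
  proof -
    have "b = - a" using that(2) by (simp add: eq_neg_iff_add_eq_0 add.commute)
    then have g: "good (Suc l) t (W a b)" using good_W[of a b] by simp
    have "W a b \<subseteq> Z3_pow (Suc l) - V (Suc l) t" using g by (auto simp: good_def)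
    moreover have "card (Z3_pow (Suc l) - V (Suc l) t) = 2"
      using V_subset by (subst card_Diff_subset) (simp_all add: card_Z3_pow card_V l)
    ultimately have "W a b = Z3_pow (Suc l) - V (Suc l) t"
      using that(1) l by (intro card_subset_eq) simp_all
    then show ?thesis using that(3) l by (auto simp: Z3_pow_def mem_V)
  qed
  \<comment> \<open>For each \<open>x\<close> other than \<open>t\<close>, the cells containing
    \<open>[x]\<close> form a sum class in the two grid indices; this is the slice in the third
    direction.\<close>
  have mem: "[x] \<in> W a b \<longleftrightarrow> a + b = 0" if x: "x \<noteq> t" for a b x
  proof -
    have V: "[x] \<notin> V (Suc l) t" using x by (simp add: mem_V)
    consider "a = 0" "b = 0" | "a = 0" "b \<noteq> 0" | "a = e" "b = 0" | "a = ?f" "b = 0"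
      | "a = e" "b = e" | "a = ?f" "b = ?f" | "a = e" "b = ?f" | "a = ?f" "b = e"
      using Z3_multiples(1)[OF e, of a] Z3_multiples(1)[OF e, of b] by blast
    then show ?thesis
    proof cases
      case 1
      then show ?thesis using full[OF card_W00 _ x] by simp
    next
      case 2
      then show ?thesis using W_0 V by simp
    next
      case 3
      then show ?thesis using se V e by simp
    next
      case 4
      then show ?thesis using sf V e by simp
    next
      case 5
      then show ?thesis using We f by simp
    next
      case 6
      then show ?thesis using We f by simp
    next
      case 7
      then show ?thesis using full[of e ?f, OF _ _ x] se by simp
    next
      case 8
      then show ?thesis using full[of ?f e, OF _ _ x] sf by simp
    qed
  qed
  \<comment> \<open>The grid uses positions 0 and \<open>Suc j\<close> out of three;
    \<open>i\<close> is the free one.\<close>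
  define i where "i = (if j = 0 then 2 else 1 :: nat)"
  have i: "i \<le> Suc (Suc l)" by (simp add: i_def l)
  have ins: "ins i x [u, v] = u # ins j v [x]" for u v x :: 3
    using j l by (cases "j = 0") (simp_all add: i_def ins_def numeral_2_eq_2)
  show ?thesis
  proof (rule Dlike_if_two_slices[OF unique_Suc_l good_U card_U i])
    fix x assume x: "x \<noteq> t"
    show "slice i x U = V (Suc (Suc l)) (s - t)"
    proof (rule set_eqI)
      fix z
      show "z \<in> slice i x U \<longleftrightarrow> z \<in> V (Suc (Suc l)) (s - t)"
      proof (cases "length z = Suc (Suc l)")
        case True
        then obtain u v where z: "z = [u, v]" using l by (auto simp: length_Suc_conv)
        have "z \<in> slice i x U \<longleftrightarrow> [x] \<in> W (u - r0) (v - c0)" by (simp add: mem_W z ins)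
        also have "\<dots> \<longleftrightarrow> z \<in> V (Suc (Suc l)) (s - t)"
          unfolding mem[OF x] using True by (auto simp: mem_V z t_def algebra_simps)
        finally show ?thesis .
      next
        case False
        then show ?thesis using slice_subset[OF U_subset, of i x] by (auto simp: mem_V Z3_pow_def)
      qed
    qed
  qed
qed

text \<open>The diagonal entries are the classes \<open>t - e\<close>. Each antidiagonal entry is
  one of the classes \<open>t + 1\<close> and \<open>t - 1\<close>, and the two differ. One of the
  two arrangements makes the small rows sum classes, the other the small columns.\<close>

lemma Dlike_if_full_diag:
  assumes full: "\<And>e. e \<noteq> 0 \<Longrightarrow> card (W e e) = 3 ^ l"
  shows "Dlike (Suc (Suc (Suc l))) s U"
proof -
  have diag: "W e e = V (Suc l) (t - e)" if "e \<noteq> 0" for e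
    using W_diag_subset[OF that] full[OF that] by (intro card_subset_eq) (simp_all add: card_V)
  have anti: "W e (- e) = V (Suc l) (t + e) \<or> W e (- e) = V (Suc l) (t - e)" if e: "e \<noteq> 0" for e
  proof -
    have f: "- e \<noteq> 0" "- e \<noteq> e" using Z3_multiples[OF e] by blast+
    have avoid: "sum_list y \<noteq> t" if "y \<in> W e (- e)" for y using W_avoids[OF that] by simp
    \<comment> \<open>A point of this entry lies in class \<open>t + e\<close> or
      \<open>t - e\<close>, so it already has a neighbour in the diagonal entry of its column or
      row.\<close>
    have ind: "indep (W e (- e))"
      unfolding indep_def
    proof (intro ballI notI)
      fix u v assume uv: "u \<in> W e (- e)" "v \<in> W e (- e)" "hdist u v = 1"
      have "sum_list u = t + e \<or> sum_list u = t - e"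
        using avoid[OF uv(1)] Z3_multiples(1)[OF e, of "sum_list u - t"] by (auto simp: algebra_simps)
      then have "u \<in> W (- e) (- e) \<or> u \<in> W e e"
        using diag[OF e] diag[OF f(1)] length_W[OF uv(1)] by (auto simp: mem_V)
      then show False
      proof
        assume "u \<in> W (- e) (- e)"
        from W_unique_neighbour[OF uv(1) this uv(2)] uv(3) f(2) show False by simp
      next
        assume "u \<in> W e e"
        from W_unique_neighbour[OF uv(1) this uv(2)] uv(3) f(2) show False by simp
      qed
    qed
    have card: "card (W e (- e)) = 3 ^ l" using card_W_diag(1)[OF e] full[OF e] by simp
    have "W e (- e) \<inter> V (Suc l) t = {}" using avoid by (auto simp: mem_V)
    from max_indep_avoiding_V[OF ind W_subset card this] show ?thesis
      using Z3_cases[of e] e by (elim disjE) (simp_all add: Z3_arith)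
  qed
  \<comment> \<open>\<open>W e 0\<close> avoids \<open>t - e\<close>; once \<open>t + e\<close> is
    excluded, counting gives the whole class \<open>t\<close>.\<close>
  have col0: "W e 0 = V (Suc l) t" if e: "e \<noteq> 0" and "\<And>y. y \<in> W e 0 \<Longrightarrow> sum_list y \<noteq> t + e" for e
  proof (rule card_subset_eq)
    show "W e 0 \<subseteq> V (Suc l) t"
    proof
      fix y assume y: "y \<in> W e 0"
      then have "sum_list y \<noteq> t + e" "sum_list y \<noteq> t - e" using that W_avoids[OF y] by simp_all
      then have "sum_list y = t"
        using Z3_multiples(1)[OF e, of "sum_list y - t"] by (auto simp: algebra_simps)
      then show "y \<in> V (Suc l) t" using length_W[OF y] by (simp add: mem_V)
    qed
  qed (simp_all add: card_V card_W_col0[OF e])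
  have ne: "V (Suc l) r \<noteq> {}" for r using card_V[of l r] by force
  have one: "(1::3) \<noteq> 0" "(- 1::3) \<noteq> 0" "(1::3) \<noteq> - 1" "- (- 1::3) = 1" by simp_all
  \<comment> \<open>If equal, both would coincide with a diagonal entry, and the three entries would
    form a corner with a common point.\<close>
  have cross: "W 1 (- 1) \<noteq> W (- 1) 1"
  proof
    assume eq: "W 1 (- 1) = W (- 1) 1"
    consider "W 1 (- 1) = W 1 1" | "W 1 (- 1) = W (- 1) (- 1)"
      using anti[OF one(1)] diag[OF one(1)] diag[OF one(2)] by auto
    then show False
    proof cases
      case 1
      moreover obtain y where "y \<in> W 1 1" using diag[OF one(1)] ne by blast
      ultimately show False using W_corner[of y 1 1 "- 1" "- 1"] eq one by simp
    next
      case 2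
      moreover obtain y where "y \<in> W (- 1) (- 1)" using diag[OF one(2)] ne by blast
      ultimately show False using W_corner[of y "- 1" "- 1" 1 1] eq one by simp
    qed
  qed
  have "W 1 (- 1) = V (Suc l) (t + 1) \<and> W (- 1) 1 = V (Suc l) (t - 1) \<or>
    W 1 (- 1) = V (Suc l) (t - 1) \<and> W (- 1) 1 = V (Suc l) (t + 1)"
    using anti[OF one(1)] anti[OF one(2)] cross unfolding one(4) by auto
  then show ?thesis
  proof
    assume X: "W 1 (- 1) = V (Suc l) (t + 1) \<and> W (- 1) 1 = V (Suc l) (t - 1)"
    \<comment> \<open>A point of class \<open>t + e\<close> in \<open>W e 0\<close> would also lie
      in \<open>W e (- e)\<close> and \<open>W (- e) (- e)\<close>, a corner at
      \<open>W e (- e)\<close>.\<close>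
    have c0: "W e 0 = V (Suc l) t" if e: "e \<noteq> 0" and We: "W e (- e) = V (Suc l) (t + e)" for e
    proof (rule col0[OF e])
      fix y assume y: "y \<in> W e 0"
      show "sum_list y \<noteq> t + e"
      proof
        assume "sum_list y = t + e"
        then have "y \<in> W e (- e)" "y \<in> W (- e) (- e)"
          using We diag[of "- e"] e length_W[OF y] by (auto simp: mem_V)
        then show False using W_corner[OF _ _ y, of "- e" "- e"] Z3_multiples[OF e] by auto
      qed
    qed
    have "W 1 0 = V (Suc l) t" using c0[of 1] X by simp
    moreover have "W (- 1) 0 = V (Suc l) t" using c0[of "- 1"] X by simp
    ultimately have "W a b = V (Suc l) (t - b)" if "a \<noteq> 0" for a b
      using that X diag[OF one(1)] diag[OF one(2)]
        Z3_multiples(1)[OF one(1), of a] Z3_multiples(1)[OF one(1), of b] by (elim disjE) simp_all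
    then show ?thesis by (rule Dlike_if_rows[OF unique_Suc_l card_U])
  next
    assume X: "W 1 (- 1) = V (Suc l) (t - 1) \<and> W (- 1) 1 = V (Suc l) (t + 1)"
    \<comment> \<open>Every entry outside column 0 is already known: row 0 from \<open>W_0\<close>,
      the others from the diagonal and \<open>X\<close>.\<close>
    have "W a b = V (Suc l) (t - a)" if "b \<noteq> 0" for a b
      using that X diag[OF one(1)] diag[OF one(2)] W_0[OF that]
        Z3_multiples(1)[OF one(1), of a] Z3_multiples(1)[OF one(1), of b] by (elim disjE) simp_all
    then show ?thesis by (rule Dlike_if_columns[OF unique_Suc_l card_U])
  qed
qed

lemma Dlike_U: "Dlike (Suc (Suc (Suc l))) s U"
proof (cases "\<exists>e. e \<noteq> 0 \<and> card (W e e) < 3 ^ l")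
  case True
  then show ?thesis using Dlike_if_small_diag by blast
next
  case False
  then show ?thesis using card_W_diag_le by (intro Dlike_if_full_diag) (meson le_antisym not_less)
qed

end

section \<open>Closing the induction\<close>

lemma unique_at_step:
  assumes l: "unique_at l" "unique_at (Suc l)"
  shows "unique_at (Suc (Suc l))"
  unfolding unique_at_def
proof (intro allI impI)
  fix s U assume g: "good (Suc (Suc (Suc l))) s U" and card: "3 ^ Suc (Suc l) < card U"
  obtain r0 where r0: "card (slice 0 r0 U) = 3 ^ Suc l + 1"
    "Dlike (Suc (Suc l)) (s - r0) (slice 0 r0 U)"
    "\<And>d. d \<noteq> r0 \<Longrightarrow> card (slice 0 d U) = 3 ^ Suc l"
    using main_slice(2)[OF l(2) g card le0] by blast
  \<comment> \<open>The large row is split along the direction in which \<open>Dlike\<close> built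
    it; its dimension rules out the base case.\<close>
  from r0(2) obtain j c0 where col: "j \<le> Suc l" "Dlike (Suc l) (s - r0 - c0) (slice j c0 (slice 0 r0 U))"
    "\<And>c. c \<noteq> c0 \<Longrightarrow> slice j c (slice 0 r0 U) = V (Suc l) (s - r0 - c0)"
    by cases auto
  interpret grid l s r0 c0 j U
    using g col by unfold_locales
  interpret full_grid l s r0 c0 j U
    using l card col(2) r0 by unfold_locales (simp_all add: W_def t_def)
  show "card U = 3 ^ Suc (Suc l) + 1 \<and> Dlike (Suc (Suc (Suc l))) s U"
    using main_slice(1)[OF l(2) g card le0] Dlike_U by simp
qed

text \<open>The step uses the two preceding dimensions, so consecutive claims are carried in
  pairs.\<close>

lemma unique_at: "unique_at l"
proof -
  have "unique_at l \<and> unique_at (Suc l)"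
    by (induction l) (simp_all add: unique_at_0 unique_at_1 unique_at_step)
  then show ?thesis ..
qed

section \<open>Uniqueness\<close>

lemma sparse_if_max_degree:
  assumes U: "U \<subseteq> Z3_pow n" and deg: "max_degree (induced (hamming3 n) U) \<le> 1"
  shows "sparse U"
  unfolding sparse_def
proof (intro ballI impI)
  fix x y z assume xyz: "x \<in> U" "y \<in> U" "z \<in> U" and h: "hdist x y = 1" "hdist x z = 1"
  let ?G = "induced (hamming3 n) U"
  have fin: "finite U" using U finite_Z3_pow finite_subset by blast
  have "degree ?G x \<le> max_degree ?G"
    unfolding max_degree_def using fin xyz by (intro Max_ge) (simp_all add: induced_def)
  then have "degree ?G x \<le> 1" using deg by simp
  moreover have "degree ?G x = card {y \<in> U. hdist x y = 1}"
    unfolding degree_def using U xyz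
    by (intro arg_cong[where f = card]) (auto simp: induced_def adj_hamming3 Z3_pow_def subset_iff)
  ultimately have "card {y \<in> U. hdist x y = 1} \<le> Suc 0" by simp
  then show "y = z" using xyz h fin by (subst (asm) card_le_Suc0_iff_eq) auto
qed

text \<open>The sum class attains the bound of \<open>card_indep_le\<close>, which fixes the size of
  a maximum independent set.\<close>

lemma maximum_independent_setD:
  assumes "maximum_independent_set (hamming3 (Suc n)) I"
  shows "indep I" "I \<subseteq> Z3_pow (Suc n)" "card I = 3 ^ n"
proof -
  have iff: "independent_set (hamming3 (Suc n)) J \<longleftrightarrow> J \<subseteq> Z3_pow (Suc n) \<and> indep J" for J
  proof -
    have "verts (hamming3 (Suc n)) = Z3_pow (Suc n)" by (simp add: hamming3_def)
    then show ?thesis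
      unfolding independent_set_def indep_def
      by (auto simp: adj_hamming3 Z3_pow_def subset_iff)
  qed
  show I: "indep I" "I \<subseteq> Z3_pow (Suc n)"
    using assms iff unfolding maximum_independent_set_def by auto
  have "independent_set (hamming3 (Suc n)) (V (Suc n) 0)"
    unfolding iff using indep_V V_subset by simp
  then have "card (V (Suc n) 0) \<le> card I"
    using assms by (simp add: maximum_independent_set_def)
  then show "card I = 3 ^ n" using card_indep_le[OF I] by (simp add: card_V)
qed

theorem theorem3p9:
  fixes n :: nat and U :: "3 list set"
  assumes "n \<ge> 1"
    and "U \<subseteq> Z3_pow n"
    and "card U \<ge> 3 ^ (n - 1) + 1"
    and "max_degree (induced (hamming3 n) U) = 1"
    and "\<exists>I. maximum_independent_set (hamming3 n) I \<and> U \<inter> I = {}"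
  shows "\<exists>\<sigma>. automorphism (hamming3 n) \<sigma> \<and> \<sigma> ` U = D_set n"
proof -
  obtain m where n: "n = Suc m" using assms(1) by (cases n) auto
  obtain I where I: "maximum_independent_set (hamming3 n) I" "U \<inter> I = {}" using assms(5) by blast
  \<comment> \<open>Moving \<open>I\<close> to the sum-zero class makes the image of
    \<open>U\<close> avoid that class.\<close>
  obtain \<sigma> where \<sigma>: "isometry n \<sigma>" "\<And>x. x \<in> Z3_pow n \<Longrightarrow> x \<in> I \<longleftrightarrow> \<sigma> x \<in> V n 0"
    using max_indep_isometry[OF maximum_independent_setD[OF I(1)[unfolded n]]] unfolding n by blast
  have "sparse U" using assms(2,4) by (intro sparse_if_max_degree) auto
  then have "good n 0 (\<sigma> ` U)"
    using \<sigma> assms(2) I(2) sparse_image[OF \<sigma>(1) assms(2)]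
    by (auto simp: good_def isometry_def Z3_pow_def subset_iff)
  moreover have "3 ^ m < card (\<sigma> ` U)"
    using card_isometry_image[OF \<sigma>(1) assms(2)] assms(3) n by simp
  ultimately have D: "Dlike n 0 (\<sigma> ` U)" unfolding n by (rule unique_atD(2)[OF unique_at])
  from Dlike_isometry[OF D] obtain \<tau> where \<tau>: "isometry n \<tau>" "\<forall>x\<in>Z3_pow n. x \<in> \<sigma> ` U \<longleftrightarrow> \<tau> x \<in> D_rev n"
    by blast
  have "\<tau> ` \<sigma> ` U = D_rev n"
    using \<tau>(2) Dlike_subset[OF D] D_rev_subset
    by (intro isometry_image_eqI[OF \<tau>(1)]) (auto simp only:)
  \<comment> \<open>Reversal turns \<open>D_rev\<close> into \<open>D_set\<close>, so the
    automorphism is a composition of three isometries.\<close>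
  then have "(rev \<circ> (\<tau> \<circ> \<sigma>)) ` U = D_set n" by (simp only: image_comp[symmetric] rev_D_rev)
  moreover have "automorphism (hamming3 n) (rev \<circ> (\<tau> \<circ> \<sigma>))"
    using \<sigma>(1) \<tau>(1) by (intro isometry_automorphism isometry_comp isometry_rev)
  ultimately show ?thesis by blast
qed

end
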